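(* Given $\mathbf t_u=(t_{u,k})_{k\in\mathcal K}$ and $\mathbf t_d=(t_{d,k})_{k\in\mathcal K}$ (vectors of nonnegative reals), an optimal solution $\mathbf S^*(\mathbf t_u,\mathbf t_d)$ to the three-stage flow-shop scheduling problem (Q) of the context is also an optimal solution to the three-stage scheduling problem (P) of the context, i.e., $T_F^*(\mathbf t_u,\mathbf t_d)=T_F(\mathbf S^*(\mathbf t_u,\mathbf t_d),\mathbf t_u,\mathbf t_d)$, where $T_F^*(\mathbf t_u,\mathbf t_d)$ is the optimal value of (P).
   Context: Let $K\ge1$, $\mathcal K=\{1,\dots,K\}$ (tasks), $T$ a deadline (in seconds), and let $t_{e,k}=N_k/F$ be fixed executing durations, where $N_k>0$ and $F>0$. $\mathbb S$ is the set of the $K!$ permutations of $\mathcal K$; for $\mathbf S\in\mathbb S$, subscript $[k]$ denotes the task at position $k$ in $\mathbf S$. Each task $k$ undergoes uploading, executing and downloading, in the same sequence $\mathbf S$ for all three operations, with durations $t_{u,k},t_{e,k},t_{d,k}$, starting times $s_{u,k},s_{e,k},s_{d,k}$ and completion times $c_{u,k},c_{e,k},c_{d,k}$. Constraints: (a) $s_{u,k}+t_{u,k}=c_{u,k}$, $s_{e,k}+t_{e,k}=c_{e,k}$, $s_{d,k}+t_{d,k}=c_{d,k}$ for all $k\in\mathcal K$; (b) $s_{u,k}\ge0$, $s_{e,k}\ge c_{u,k}$, $s_{d,k}\ge c_{e,k}$ for all $k\in\mathcal K$; (c) $c_{d,k}\le T$ for all $k\in\mathcal K$; (d) $s_{u,[k]}\ge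 c_{u,[k-1]}$, $s_{e,[k]}\ge c_{e,[k-1]}$, $s_{d,[k]}\ge c_{d,[k-1]}$ for $k=2,\dots,K$; (e) $s_{d,[1]}\ge c_{u,[K]}$ (all uploading is completed before any downloading starts). Define $$\widetilde T_F(\mathbf S,\mathbf t_u,\mathbf t_d)=\max_{1\le i\le j\le K}\left(\Big(\sum_{k=1}^{j}t_{e,[k]}-\sum_{k=1}^{j-1}t_{d,[k]}\Big)+\Big(\sum_{k=1}^{i}t_{u,[k]}-\sum_{k=1}^{i-1}t_{e,[k]}\Big)\right)+\sum_{k=1}^{K}t_{d,[k]},$$ $$T_F(\mathbf S,\mathbf t_u,\mathbf t_d)=\max\left\{\max_{1\le i\le j\le K}\left(\Big(\sum_{k=1}^{j}t_{e,[k]}-\sum_{k=1}^{j-1}t_{d,[k]}\Big)+\Big(\sum_{k=1}^{i}t_{u,[k]}-\sum_{k=1}^{i-1}t_{e,[k]}\Big)\right),\ \sum_{k=1}^{K}t_{u,[k]}\right\}+\sum_{k=1}^{K}t_{d,[k]}.$$ ($T_F$ is the minimum total completion time of all tasks under $\mathbf S,\mathbf t_u,\mathbf t_d$; $\widetilde T_F$ is the minimum total completion time when (e) is dropped.) For any $\mathbf t_u$ and $\mathbf t_d$, the two problems are as follows (the minimum is written over $\mathbf S$ only; starting and completion times appear only in the constraints). Problem (P): $T_F^*(\mathbf t_u,\mathbf t_d)=\min_{\mathbf S\in\mathbb S}T_F(\mathbf S,\mathbf t_u,\mathbf t_d)$ subject to (a), (b), (c), (d), (e). Problem (Q): $\widetilde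 T_F^*(\mathbf t_u,\mathbf t_d)=\min_{\mathbf S\in\mathbb S}\widetilde T_F(\mathbf S,\mathbf t_u,\mathbf t_d)$ subject to (a), (b), (c), (d); $\mathbf S^*(\mathbf t_u,\mathbf t_d)$ denotes an optimal solution of (Q).
   Formalization: Problem (P) is assumed to have a feasible sequence; otherwise the claim fails: K=2, t_u=t_d=(1,1), t_e=(0.1,0.1), T=3.5 makes (Q) solvable (optimal value 3.1) while (P) needs total time 4 > T and has no solution. *)

theory Defs
  imports Complex_Main "HOL-Combinatorics.Permutations"
begin

text \<open>
  Tasks are the numbers in \<open>{1..K}\<close>. A sequence is a permutation \<open>S permutes {1..K}\<close>, with \<open>S k\<close> the
  task at position \<open>k\<close>. All durations and times are functions of the task, not of the position.
\<close>

definition flow_shop_constraints ::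
  "nat \<Rightarrow> real \<Rightarrow> (nat \<Rightarrow> real) \<Rightarrow> (nat \<Rightarrow> real) \<Rightarrow> (nat \<Rightarrow> real) \<Rightarrow> (nat \<Rightarrow> nat) \<Rightarrow>
   (nat \<Rightarrow> real) \<Rightarrow> (nat \<Rightarrow> real) \<Rightarrow> (nat \<Rightarrow> real) \<Rightarrow>
   (nat \<Rightarrow> real) \<Rightarrow> (nat \<Rightarrow> real) \<Rightarrow> (nat \<Rightarrow> real) \<Rightarrow> bool" where
  "flow_shop_constraints K T tu te td S su se sd cu ce cd \<longleftrightarrow>
     (\<forall>k\<in>{1..K}. su k + tu k = cu k \<and> se k + te k = ce k \<and> sd k + td k = cd k) \<and>
     (\<forall>k\<in>{1..K}. su k \<ge> 0 \<and> se k \<ge> cu k \<and> sd k \<ge> ce k) \<and>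
     (\<forall>k\<in>{1..K}. cd k \<le> T) \<and>
     (\<forall>k\<in>{2..K}. su (S k) \<ge> cu (S (k - 1)) \<and> se (S k) \<ge> ce (S (k - 1)) \<and> sd (S k) \<ge> cd (S (k - 1)))"

text \<open>
  The starting and completion times are not decision variables of the minimisation, which ranges
  over sequences only; a sequence is feasible if some choice of times meets the constraints.
\<close>

definition feasible_Q ::
  "nat \<Rightarrow> real \<Rightarrow> (nat \<Rightarrow> real) \<Rightarrow> (nat \<Rightarrow> real) \<Rightarrow> (nat \<Rightarrow> real) \<Rightarrow> (nat \<Rightarrow> nat) \<Rightarrow> bool" where
  "feasible_Q K T tu te td S \<longleftrightarrow>
     S permutes {1..K} \<and>
     (\<exists>su se sd cu ce cd. flow_shop_constraints K T tu te td S su se sd cu ce cd)"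

text \<open>
  The last conjunct is the additional constraint of the problem (P): all uploading is completed
  before any downloading starts.
\<close>

definition feasible_P ::
  "nat \<Rightarrow> real \<Rightarrow> (nat \<Rightarrow> real) \<Rightarrow> (nat \<Rightarrow> real) \<Rightarrow> (nat \<Rightarrow> real) \<Rightarrow> (nat \<Rightarrow> nat) \<Rightarrow> bool" where
  "feasible_P K T tu te td S \<longleftrightarrow>
     S permutes {1..K} \<and>
     (\<exists>su se sd cu ce cd. flow_shop_constraints K T tu te td S su se sd cu ce cd \<and>
        sd (S 1) \<ge> cu (S K))"

definition critical_max ::
  "nat \<Rightarrow> (nat \<Rightarrow> real) \<Rightarrow> (nat \<Rightarrow> real) \<Rightarrow> (nat \<Rightarrow> real) \<Rightarrow> (nat \<Rightarrow> nat) \<Rightarrow> real" where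
  "critical_max K tu te td S =
     Max {((\<Sum>k=1..j. te (S k)) - (\<Sum>k=1..j-1. td (S k))) +
          ((\<Sum>k=1..i. tu (S k)) - (\<Sum>k=1..i-1. te (S k))) | i j. 1 \<le> i \<and> i \<le> j \<and> j \<le> K}"

definition completion_time_Q ::
  "nat \<Rightarrow> (nat \<Rightarrow> real) \<Rightarrow> (nat \<Rightarrow> real) \<Rightarrow> (nat \<Rightarrow> real) \<Rightarrow> (nat \<Rightarrow> nat) \<Rightarrow> real" where
  "completion_time_Q K tu te td S = critical_max K tu te td S + (\<Sum>k=1..K. td (S k))"

definition completion_time_P ::
  "nat \<Rightarrow> (nat \<Rightarrow> real) \<Rightarrow> (nat \<Rightarrow> real) \<Rightarrow> (nat \<Rightarrow> real) \<Rightarrow> (nat \<Rightarrow> nat) \<Rightarrow> real" where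
  "completion_time_P K tu te td S =
     max (critical_max K tu te td S) (\<Sum>k=1..K. tu (S k)) + (\<Sum>k=1..K. td (S k))"

definition optimal_Q ::
  "nat \<Rightarrow> real \<Rightarrow> (nat \<Rightarrow> real) \<Rightarrow> (nat \<Rightarrow> real) \<Rightarrow> (nat \<Rightarrow> real) \<Rightarrow> (nat \<Rightarrow> nat) \<Rightarrow> bool" where
  "optimal_Q K T tu te td = is_arg_min (completion_time_Q K tu te td) (feasible_Q K T tu te td)"

definition optimal_P ::
  "nat \<Rightarrow> real \<Rightarrow> (nat \<Rightarrow> real) \<Rightarrow> (nat \<Rightarrow> real) \<Rightarrow> (nat \<Rightarrow> real) \<Rightarrow> (nat \<Rightarrow> nat) \<Rightarrow> bool" where
  "optimal_P K T tu te td = is_arg_min (completion_time_P K tu te td) (feasible_P K T tu te td)"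

text \<open>Meaningful only if some sequence is feasible: otherwise this is \<open>Min {}\<close>.\<close>

definition optimal_value_P ::
  "nat \<Rightarrow> real \<Rightarrow> (nat \<Rightarrow> real) \<Rightarrow> (nat \<Rightarrow> real) \<Rightarrow> (nat \<Rightarrow> real) \<Rightarrow> real" where
  "optimal_value_P K T tu te td =
     Min (completion_time_P K tu te td ` {S. feasible_P K T tu te td S})"

end

theory Submission
  imports Defs
begin

text \<open>
  Uploading without idle time and downloading as late as the deadline allows turns a schedule of (Q)
  into one of (P) exactly if the total uploading and downloading time is at most \<open>T\<close>. This bound does
  not depend on the sequence, so once (P) is feasible both problems have the same feasible sequences.
  The objective of (P) is a nondecreasing function of that of (Q), since it differs only by the maximum
  with a total that is the same for all sequences.
\<close>

text \<open>Operations of one stage do not overlap, so the durations telescope along the chain.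
  Indices here are positions: each use passes times composed with \<open>S\<close>.\<close>

lemma sum_durations_le_completion:
  fixes s t c :: "nat \<Rightarrow> real"
  assumes st: "\<And>k. k \<in> {1..K} \<Longrightarrow> s k + t k = c k"
    and prec: "\<And>k. k \<in> {2..K} \<Longrightarrow> s k \<ge> c (k - 1)"
    and "1 \<le> i" "i \<le> j" "j \<le> K"
  shows "s i + (\<Sum>k=i..j. t k) \<le> c j"
  using \<open>i \<le> j\<close> \<open>j \<le> K\<close>
proof (induction j rule: dec_induct)
  case base
  then show ?case using st[of i] \<open>1 \<le> i\<close> by simp
next
  case (step n)
  then have "s i + (\<Sum>k=i..n. t k) \<le> c n" by simp
  moreover have "c n \<le> s (Suc n)" using prec[of "Suc n"] step \<open>1 \<le> i\<close> by simp
  moreover have "s (Suc n) + t (Suc n) = c (Suc n)" using st[of "Suc n"] step by simp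
  ultimately show ?case using step by simp
qed

lemma sum_over_sequence:
  fixes f :: "nat \<Rightarrow> real"
  assumes "S permutes {1..K}"
  shows "(\<Sum>k=1..K. f (S k)) = (\<Sum>k=1..K. f k)"
  using sum.permute[OF assms, of f] by simp

text \<open>All uploads fit one after another between time 0 and \<open>cu (S K)\<close>, all
  downloads between \<open>sd (S 1)\<close> and \<open>T\<close>, and the additional constraint of
  (P) puts the first interval before the second.\<close>

lemma total_time_le_deadline:
  assumes "K \<ge> 1" and feas: "feasible_P K T tu te td S"
  shows "(\<Sum>k=1..K. tu k) + (\<Sum>k=1..K. td k) \<le> T"
proof -
  obtain su se sd cu ce cd where fs: "flow_shop_constraints K T tu te td S su se sd cu ce cd"
    and up: "sd (S 1) \<ge> cu (S K)" and S: "S permutes {1..K}"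
    using feas unfolding feasible_P_def by blast
  note f = fs[unfolded flow_shop_constraints_def]
  have SK: "S k \<in> {1..K}" if "k \<in> {1..K}" for k using permutes_in_image[OF S] that by blast
  have "su (S 1) + (\<Sum>k=1..K. tu (S k)) \<le> cu (S K)"
    by (rule sum_durations_le_completion[where s="\<lambda>k. su (S k)" and c="\<lambda>k. cu (S k)" and K=K])
      (use f SK \<open>K \<ge> 1\<close> in auto)
  moreover have "sd (S 1) + (\<Sum>k=1..K. td (S k)) \<le> cd (S K)"
    by (rule sum_durations_le_completion[where s="\<lambda>k. sd (S k)" and c="\<lambda>k. cd (S k)" and K=K])
      (use f SK \<open>K \<ge> 1\<close> in auto)
  moreover have "su (S 1) \<ge> 0" "cd (S K) \<le> T" using f SK \<open>K \<ge> 1\<close> by auto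
  ultimately show ?thesis using up sum_over_sequence[OF S, of tu] sum_over_sequence[OF S, of td] by linarith
qed

lemma feasible_P_imp_feasible_Q:
  "feasible_P K T tu te td S \<Longrightarrow> feasible_Q K T tu te td S"
  unfolding feasible_P_def feasible_Q_def by blast

text \<open>Uploads move earlier, downloads move later and executions stay in place, so the
  constraints between stages only become looser.\<close>

lemma feasible_P_of_feasible_Q:
  assumes "K \<ge> 1"
    and tu: "\<And>k. k \<in> {1..K} \<Longrightarrow> tu k \<ge> 0"
    and td: "\<And>k. k \<in> {1..K} \<Longrightarrow> td k \<ge> 0"
    and feas: "feasible_Q K T tu te td S"
    and total: "(\<Sum>k=1..K. tu k) + (\<Sum>k=1..K. td k) \<le> T"
  shows "feasible_P K T tu te td S"
proof -
  obtain su se sd cu ce cd where fs: "flow_shop_constraints K T tu te td S su se sd cu ce cd"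
    and S: "S permutes {1..K}"
    using feas unfolding feasible_Q_def by blast
  note f = fs[unfolded flow_shop_constraints_def]
  have SK: "S k \<in> {1..K}" if "k \<in> {1..K}" for k using permutes_in_image[OF S] that by blast
  \<comment> \<open>Times are indexed by tasks, so the partial sums below need the position
    \<open>p k\<close> of task \<open>k\<close>.\<close>
  define p where "p = inv S"
  have pS[simp]: "p (S k) = k" for k unfolding p_def by (rule permutes_inverses(2)[OF S])
  have Sp[simp]: "S (p k) = k" for k unfolding p_def by (rule permutes_inverses(1)[OF S])
  have pK: "p k \<in> {1..K}" if "k \<in> {1..K}" for k
    using permutes_in_image[OF permutes_inv[OF S]] that unfolding p_def by blast
  \<comment> \<open>Earliest possible completion: uploading runs without idle time from 0.\<close>
  define cu' where "cu' k = (\<Sum>m=1..p k. tu (S m))" for k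
  \<comment> \<open>Latest possible start: the downloads from position \<open>p k\<close> on fill
    the time up to \<open>T\<close> without gaps.\<close>
  define sd' where "sd' k = T - (\<Sum>m=p k..K. td (S m))" for k
  have cu'_le: "cu' k \<le> cu k" if k: "k \<in> {1..K}" for k
  proof -
    have "su (S 1) + (\<Sum>m=1..p k. tu (S m)) \<le> cu (S (p k))"
      by (rule sum_durations_le_completion[where s="\<lambda>k. su (S k)" and c="\<lambda>k. cu (S k)" and K=K])
        (use f SK pK[OF k] in auto)
    moreover have "su (S 1) \<ge> 0" using f SK \<open>K \<ge> 1\<close> by auto
    ultimately show ?thesis by (simp add: cu'_def)
  qed
  have sd'_ge: "sd k \<le> sd' k" if k: "k \<in> {1..K}" for k
  proof -
    have "sd (S (p k)) + (\<Sum>m=p k..K. td (S m)) \<le> cd (S K)"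
      by (rule sum_durations_le_completion[where s="\<lambda>k. sd (S k)" and c="\<lambda>k. cd (S k)" and K=K])
        (use f SK pK[OF k] in auto)
    moreover have "cd (S K) \<le> T" using f SK \<open>K \<ge> 1\<close> by auto
    ultimately show ?thesis by (simp add: sd'_def)
  qed
  have cu'_start: "cu' k - tu k = (\<Sum>m=1..p k - 1. tu (S m))" if k: "k \<in> {1..K}" for k
  proof (cases "p k")
    case 0
    then show ?thesis using pK[OF k] by simp
  next
    case (Suc n)
    then show ?thesis using Sp[of k] by (simp add: cu'_def)
  qed
  have cd'_end: "sd' k + td k = T - (\<Sum>m=Suc (p k)..K. td (S m))" if k: "k \<in> {1..K}" for k
    using pK[OF k] sum.atLeast_Suc_atMost[of "p k" K "\<lambda>m. td (S m)"] by (simp add: sd'_def)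
  have "flow_shop_constraints K T tu te td S (\<lambda>k. cu' k - tu k) se sd' cu' ce (\<lambda>k. sd' k + td k)"
    unfolding flow_shop_constraints_def
  proof (intro conjI ballI)
    fix k assume k: "k \<in> {1..K}"
    have "0 \<le> (\<Sum>m=1..p k - 1. tu (S m))"
      using pK[OF k] by (intro sum_nonneg tu SK) auto
    then show "0 \<le> cu' k - tu k" using cu'_start[OF k] by simp
    show "cu' k \<le> se k" using cu'_le[OF k] f k by force
    show "ce k \<le> sd' k" using sd'_ge[OF k] f k by force
    \<comment> \<open>The tasks after \<open>k\<close> still have to be downloaded before
      \<open>T\<close>, which takes a nonnegative time.\<close>
    have "0 \<le> (\<Sum>m=Suc (p k)..K. td (S m))"
      using pK[OF k] by (intro sum_nonneg td SK) auto
    then show "sd' k + td k \<le> T" using cd'_end[OF k] by simp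
  next
    fix k assume k: "k \<in> {2..K}"
    have S1: "S k \<in> {1..K}" "S (k - 1) \<in> {1..K}" by (rule SK, use k in force)+
    show "cu' (S (k - 1)) \<le> cu' (S k) - tu (S k)"
      using cu'_start[OF S1(1)] by (simp add: cu'_def)
    show "sd' (S (k - 1)) + td (S (k - 1)) \<le> sd' (S k)"
      using cd'_end[OF S1(2)] k by (simp add: sd'_def)
  qed (use f in auto)
  \<comment> \<open>The left side is the total uploading time, the right side \<open>T\<close> minus
    the total downloading time, so this is exactly \<open>total\<close>.\<close>
  moreover have "cu' (S K) \<le> sd' (S 1)"
    using total sum_over_sequence[OF S, of tu] sum_over_sequence[OF S, of td]
    by (simp add: cu'_def sd'_def)
  ultimately show ?thesis unfolding feasible_P_def using S by blast
qed

text \<open>Adding the total downloading time commutes with \<open>max\<close>, and the totals are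
  invariant under reordering. The second argument is thus a constant, which makes the dependence on
  the objective of (Q) monotone.\<close>

lemma completion_time_P_alt:
  assumes "S permutes {1..K}"
  shows "completion_time_P K tu te td S =
    max (completion_time_Q K tu te td S) ((\<Sum>k=1..K. tu k) + (\<Sum>k=1..K. td k))"
  unfolding completion_time_P_def completion_time_Q_def sum_over_sequence[OF assms] by simp

text \<open>There are finitely many permutations, so \<open>Min\<close> is a true minimum, and
  \<open>S\<close> attains it.\<close>

lemma optimal_value_P_eq:
  assumes "optimal_P K T tu te td S"
  shows "optimal_value_P K T tu te td = completion_time_P K tu te td S"
  unfolding optimal_value_P_def
proof (rule Min_eqI)
  have "{S. feasible_P K T tu te td S} \<subseteq> {S. S permutes {1..K}}"
    by (auto simp: feasible_P_def)
  then show "finite (completion_time_P K tu te td ` {S. feasible_P K T tu te td S})"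
    by (intro finite_imageI finite_subset[OF _ finite_permutations[of "{1..K}"]]) auto
qed (use assms in \<open>auto simp: optimal_P_def is_arg_min_linorder\<close>)

theorem lemma3:
  fixes K :: nat and T F :: real and N tu te td :: "nat \<Rightarrow> real" and S :: "nat \<Rightarrow> nat"
  assumes "K \<ge> 1"
    and "F > 0"
    and "\<And>k. k \<in> {1..K} \<Longrightarrow> N k > 0"
    and "\<And>k. k \<in> {1..K} \<Longrightarrow> te k = N k / F"
    and "\<And>k. k \<in> {1..K} \<Longrightarrow> tu k \<ge> 0"
    and "\<And>k. k \<in> {1..K} \<Longrightarrow> td k \<ge> 0"
    and "\<exists>S'. feasible_P K T tu te td S'"
    and "optimal_Q K T tu te td S"
  shows "optimal_P K T tu te td S \<and>
         optimal_value_P K T tu te td = completion_time_P K tu te td S"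
proof -
  obtain S' where "feasible_P K T tu te td S'" using assms(7) by blast
  \<comment> \<open>The bound obtained from \<open>S'\<close> mentions no sequence, so it can be
    applied to \<open>S\<close>.\<close>
  then have total: "(\<Sum>k=1..K. tu k) + (\<Sum>k=1..K. td k) \<le> T"
    by (rule total_time_le_deadline[OF assms(1)])
  have SQ: "feasible_Q K T tu te td S"
    and min: "\<And>R. feasible_Q K T tu te td R \<Longrightarrow>
      completion_time_Q K tu te td S \<le> completion_time_Q K tu te td R"
    using assms(8) by (auto simp: optimal_Q_def is_arg_min_linorder)
  have SP: "feasible_P K T tu te td S"
    by (rule feasible_P_of_feasible_Q[OF assms(1,5,6) SQ total])
  have "completion_time_P K tu te td S \<le> completion_time_P K tu te td R"
    if R: "feasible_P K T tu te td R" for R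
  proof -
    have "S permutes {1..K}" "R permutes {1..K}" using SP R by (auto simp: feasible_P_def)
    then show ?thesis
      using min[OF feasible_P_imp_feasible_Q[OF R]] by (auto simp: completion_time_P_alt)
  qed
  then have "optimal_P K T tu te td S"
    using SP by (auto simp: optimal_P_def is_arg_min_linorder)
  then show ?thesis using optimal_value_P_eq by blast
qed

end
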